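(* Let $d,e\ge1$ and let $P(x_1,\dots,x_e)=\prod_{i=1}^dP_i(x_1,\dots,x_e)$ be a product of $d$ non-zero linear forms $P_i$ in the variables $x_1,\dots,x_e$ with non-negative real coefficients. Let $A_{ij}=1$ if the coefficient of $x_j$ in $P_i$ is non-zero and $A_{ij}=0$ otherwise. For $s>0$ let \[ \mathbb{I}(P;s)=\int_{(0,1]^e}\frac{dx_1\cdots dx_e}{P(x_1,\dots,x_e)^s},\qquad \hat s(P)=\sup\{t>0:\ \mathbb{I}(P;t)<+\infty\}. \] Then \[ \frac{1}{\hat s(P)}=\max_{\substack{J\subseteq\{1,\dots,e\}\\ J\ne\emptyset}}\frac{1}{\#J}\,\#\big\{i\in\{1,\dots,d\}:\ \{j: A_{ij}=1\}\subseteq J\big\}. \] Moreover, the integral $\mathbb{I}(P;\hat s(P))$ diverges.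
   Context: A linear form here is a homogeneous polynomial of degree one. *)

theory Defs
  imports "HOL-Analysis.Analysis"
begin

text \<open>
  A linear form in \<open>x\<^sub>1, \<dots>, x\<^sub>e\<close> is given by its coefficient family \<open>c\<close>; the values of \<open>c\<close> outside
  \<open>{1..e}\<close> are irrelevant.
\<close>

definition linear_form :: "nat \<Rightarrow> (nat \<Rightarrow> real) \<Rightarrow> (nat \<Rightarrow> real) \<Rightarrow> real" where
  "linear_form e c x = (\<Sum>j=1..e. c j * x j)"

definition nonzero_form :: "nat \<Rightarrow> (nat \<Rightarrow> real) \<Rightarrow> bool" where
  "nonzero_form e c \<longleftrightarrow> (\<exists>j\<in>{1..e}. c j \<noteq> 0)"

definition form_product :: "nat \<Rightarrow> nat \<Rightarrow> (nat \<Rightarrow> nat \<Rightarrow> real) \<Rightarrow> (nat \<Rightarrow> real) \<Rightarrow> real" where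
  "form_product d e c x = (\<Prod>i=1..d. linear_form e (c i) x)"

definition incidence :: "(nat \<Rightarrow> nat \<Rightarrow> real) \<Rightarrow> nat \<Rightarrow> nat \<Rightarrow> nat" where
  "incidence c i j = (if c i j \<noteq> 0 then 1 else 0)"

text \<open>
  Points of \<open>(0,1]\<^sup>e\<close> are extensional functions on \<open>{1..e}\<close>, and \<open>dx\<^sub>1 \<cdots> dx\<^sub>e\<close> is the product of \<open>e\<close>
  copies of Lebesgue measure. The integral takes its value in \<open>[0, \<infinity>]\<close>. It is meant for \<open>P\<close> positive
  on the cube, where \<open>powr\<close> is the usual real power.
\<close>

definition cube_integral :: "nat \<Rightarrow> ((nat \<Rightarrow> real) \<Rightarrow> real) \<Rightarrow> real \<Rightarrow> ennreal" where
  "cube_integral e P s =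
     (\<integral>\<^sup>+x\<in>(\<Pi>\<^sub>E j\<in>{1..e}. {0<..1}). ennreal (1 / (P x powr s)) \<partial>(\<Pi>\<^sub>M j\<in>{1..e}. lborel))"

text \<open>
  The supremum is taken in the extended reals, so that it is meaningful without assuming that the
  set is non-empty or bounded (the supremum of the empty set is \<open>-\<infinity>\<close>).
\<close>

definition critical_exponent :: "nat \<Rightarrow> ((nat \<Rightarrow> real) \<Rightarrow> real) \<Rightarrow> ereal" where
  "critical_exponent e P = Sup (ereal ` {t. t > 0 \<and> cube_integral e P t < \<infinity>})"

end

theory Submission imports Defs begin

text \<open>
  Write \<open>S\<^sub>i\<close> for the set of variables occurring in \<open>P\<^sub>i\<close>, \<open>N(J)\<close> for the number of \<open>i\<close> with
  \<open>S\<^sub>i \<subseteq> J\<close>, and \<open>M\<close> for the maximum of \<open>N(J) / #J\<close>. As \<open>M \<ge> d / e > 0\<close>, the theorem follows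
  once the integral is shown to be finite for \<open>0 < s < 1 / M\<close> and infinite for \<open>s \<ge> 1 / M\<close>.

  On the cube \<open>P\<^sub>i\<close> is comparable to \<open>max {x\<^sub>j | j \<in> S\<^sub>i}\<close>, so that, up to a bounded error,
  \<open>- ln P\<^sub>i\<close> equals \<open>min {y\<^sub>j | j \<in> S\<^sub>i}\<close>, where \<open>y\<^sub>j = - ln x\<^sub>j \<ge> 0\<close>. The heart of the convergence proof
  is the combinatorial inequality \<open>\<Sum>\<^sub>i min {y\<^sub>j | j \<in> S\<^sub>i} \<le> M \<Sum>\<^sub>j y\<^sub>j\<close>
  (\<open>sum_le_of_subset_counts\<close>): the left side is \<open>\<integral>\<^sub>0\<^sup>\<infinity> N({j | y\<^sub>j > t}) dt\<close>, the right side is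
  \<open>M \<integral>\<^sub>0\<^sup>\<infinity> #{j | y\<^sub>j > t} dt\<close>, and the integrands compare by definition of \<open>M\<close>. Exponentiating
  bounds \<open>P\<^sup>-\<^sup>s\<close> by a constant times \<open>\<Prod>\<^sub>j x\<^sub>j\<^sup>-\<^sup>s\<^sup>M\<close>, whose integral is a product of
  one-dimensional integrals that converge when \<open>s M < 1\<close>.

  For divergence take \<open>J\<close> with \<open>s N(J) \<ge> #J\<close>. On the part of the cube where \<open>x\<^sub>j \<le> t\<close> for all
  \<open>j \<in> J\<close>, the forms with \<open>S\<^sub>i \<subseteq> J\<close> are \<open>O(t)\<close> and the others bounded, so \<open>P\<^sup>-\<^sup>s\<close> is at
  least a constant times \<open>t\<^sup>-\<^sup>#\<^sup>J\<close>, while this part has volume \<open>t\<^sup>#\<^sup>J\<close>. Its contribution to the integral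
  therefore stays bounded away from \<open>0\<close> as these sets shrink to the empty set, which is impossible
  for a finite integral (\<open>cube_integral_infinite\<close>).
\<close>

section \<open>The combinatorial inequality\<close>

text \<open>
  This is a discrete layer-cake argument. The bottom layer of \<open>y\<close> is \<open>m\<close> times the indicator of
  \<open>J = {j | y\<^sub>j > 0}\<close>, with \<open>m\<close> the least positive value of \<open>y\<close>; removing it lowers the right side by
  \<open>M m #J\<close>, the left side by \<open>m N(J)\<close>, and makes the set of positive values smaller. The numbers
  \<open>z\<^sub>i\<close> stand for minima of \<open>y\<close> over \<open>S\<^sub>i\<close>; they are allowed to be smaller, even negative.
\<close>

lemma sum_le_of_subset_counts:
  fixes y :: "'a \<Rightarrow> real" and z :: "'b \<Rightarrow> real"
  assumes fin: "finite E" "finite I"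
    and S: "\<And>i. i \<in> I \<Longrightarrow> S i \<subseteq> E" "\<And>i. i \<in> I \<Longrightarrow> S i \<noteq> {}"
    and count: "\<And>J. J \<subseteq> E \<Longrightarrow> J \<noteq> {} \<Longrightarrow> real (card {i\<in>I. S i \<subseteq> J}) \<le> M * real (card J)"
    and "\<And>j. j \<in> E \<Longrightarrow> 0 \<le> y j"
    and "\<And>i j. i \<in> I \<Longrightarrow> j \<in> S i \<Longrightarrow> z i \<le> y j"
  shows "(\<Sum>i\<in>I. z i) \<le> M * (\<Sum>j\<in>E. y j)"
  using assms(6,7)
proof (induction "card {j\<in>E. y j > 0}" arbitrary: y z rule: less_induct)
  case less
  define J where "J = {j\<in>E. y j > 0}"
  have JE: "J \<subseteq> E" and finJ: "finite J" using fin by (auto simp: J_def)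
  have zero: "y j = 0" if "j \<in> E" "j \<notin> J" for j
    using less.prems(1)[of j] that by (force simp: J_def)
  show ?case
  proof (cases "J = {}")
    case True
    then have y0: "y j = 0" if "j \<in> E" for j using zero that by simp
    have "z i \<le> 0" if i: "i \<in> I" for i
    proof -
      obtain j where "j \<in> S i" using S(2)[OF i] by blast
      then show ?thesis using less.prems(2)[OF i] y0 S(1)[OF i] by force
    qed
    then have "(\<Sum>i\<in>I. z i) \<le> 0" by (rule sum_nonpos)
    then show ?thesis using y0 by simp
  next
    case False
    define m where "m = Min (y ` J)"
    have "m \<in> y ` J" unfolding m_def using False finJ by (intro Min_in) auto
    then obtain k where k: "k \<in> J" "y k = m" by blast
    have m: "m > 0" using k by (auto simp: J_def)
    have m_le: "m \<le> y j" if "j \<in> J" for j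
      unfolding m_def using that finJ by (intro Min_le) auto
    define y' where "y' = (\<lambda>j. y j - (if j \<in> J then m else 0))"
    define z' where "z' = (\<lambda>i. z i - (if S i \<subseteq> J then m else 0))"
    have "{j\<in>E. y' j > 0} \<subseteq> J - {k}"
      using k zero by (auto simp: y'_def J_def split: if_splits)
    then have "card {j\<in>E. y' j > 0} < card J"
      using k finJ by (intro psubset_card_mono) auto
    moreover have y'_nonneg: "0 \<le> y' j" if "j \<in> E" for j
      using less.prems(1)[OF that] m_le[of j] by (auto simp: y'_def)
    moreover have "z' i \<le> y' j" if i: "i \<in> I" and j: "j \<in> S i" for i j
    proof (cases "S i \<subseteq> J")
      case True
      then show ?thesis using less.prems(2)[OF i j] j by (auto simp: y'_def z'_def)
    next
      \<comment> \<open>Some variable of \<open>S i\<close> lies outside \<open>J\<close>, where \<open>y\<close> vanishes, so \<open>z i\<close> is not positive.\<close>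
      case False
      then obtain l where l: "l \<in> S i" "l \<notin> J" by blast
      have "z i \<le> 0" using less.prems(2)[OF i l(1)] zero[of l] l S(1)[OF i] by auto
      then show ?thesis using False y'_nonneg[of j] j S(1)[OF i] by (auto simp: z'_def)
    qed
    ultimately have IH: "(\<Sum>i\<in>I. z' i) \<le> M * (\<Sum>j\<in>E. y' j)"
      by (intro less.hyps) (auto simp: J_def)
    have "(\<Sum>i\<in>I. if S i \<subseteq> J then m else 0) = m * real (card {i\<in>I. S i \<subseteq> J})"
      using fin by (simp add: sum.If_cases Int_def)
    then have z_sum: "(\<Sum>i\<in>I. z i) = (\<Sum>i\<in>I. z' i) + m * real (card {i\<in>I. S i \<subseteq> J})"
      by (simp add: z'_def sum_subtractf)
    have "(\<Sum>j\<in>E. if j \<in> J then m else 0) = m * real (card J)"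
      using fin JE by (simp add: sum.If_cases Int_absorb1)
    then have y_sum: "(\<Sum>j\<in>E. y j) = (\<Sum>j\<in>E. y' j) + m * real (card J)"
      by (simp add: y'_def sum_subtractf)
    have "m * real (card {i\<in>I. S i \<subseteq> J}) \<le> m * (M * real (card J))"
      using count[OF JE False] m by simp
    then show ?thesis unfolding z_sum y_sum using IH by (simp add: algebra_simps)
  qed
qed

section \<open>Linear forms on the cube\<close>

definition form_support :: "nat \<Rightarrow> (nat \<Rightarrow> real) \<Rightarrow> nat set" where
  "form_support e a = {j\<in>{1..e}. a j \<noteq> 0}"

lemma form_support_incidence:
  "{j\<in>{1..e}. incidence c i j = 1} = form_support e (c i)"
  by (auto simp: form_support_def incidence_def)

lemma linear_form_ge_term:
  assumes "\<And>j. j \<in> {1..e} \<Longrightarrow> 0 \<le> a j" "\<And>j. j \<in> {1..e} \<Longrightarrow> 0 \<le> x j" "j \<in> {1..e}"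
  shows "a j * x j \<le> linear_form e a x"
  unfolding linear_form_def using assms by (intro member_le_sum) auto

lemma linear_form_pos:
  assumes "\<And>j. j \<in> {1..e} \<Longrightarrow> 0 \<le> a j" "nonzero_form e a" "\<And>j. j \<in> {1..e} \<Longrightarrow> 0 < x j"
  shows "0 < linear_form e a x"
proof -
  obtain j where j: "j \<in> {1..e}" "a j \<noteq> 0" using assms(2) by (auto simp: nonzero_form_def)
  have "0 < a j * x j" using j assms(1)[of j] assms(3)[of j] by (simp add: order_less_le)
  also have "\<dots> \<le> linear_form e a x"
    using assms(1) less_imp_le[OF assms(3)] j(1) by (rule linear_form_ge_term)
  finally show ?thesis .
qed

lemma linear_form_le:
  assumes "\<And>j. j \<in> {1..e} \<Longrightarrow> 0 \<le> a j" "\<And>j. j \<in> form_support e a \<Longrightarrow> x j \<le> t"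
  shows "linear_form e a x \<le> (\<Sum>j=1..e. a j) * t"
  unfolding linear_form_def sum_distrib_right
proof (rule sum_mono)
  fix j assume "j \<in> {1..e}"
  then show "a j * x j \<le> a j * t"
    using assms by (cases "a j = 0") (auto simp: form_support_def intro!: mult_left_mono)
qed

lemma form_product_pos:
  assumes "\<And>i j. i \<in> {1..d} \<Longrightarrow> j \<in> {1..e} \<Longrightarrow> c i j \<ge> 0"
    and "\<And>i. i \<in> {1..d} \<Longrightarrow> nonzero_form e (c i)"
    and "\<And>j. j \<in> {1..e} \<Longrightarrow> 0 < x j"
  shows "0 < form_product d e c x"
  unfolding form_product_def using assms by (intro prod_pos) (auto intro!: linear_form_pos)

lemma form_product_measurable [measurable]:
  "form_product d e c \<in> borel_measurable (\<Pi>\<^sub>M j\<in>{1..e}. lborel)"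
  unfolding form_product_def[abs_def] linear_form_def by measurable

section \<open>Convergence\<close>

lemma nn_integral_powr_unit_interval_finite:
  fixes b :: real
  assumes "b < 1"
  shows "(\<integral>\<^sup>+x\<in>{0<..1}. ennreal (x powr (-b)) \<partial>lborel) < \<infinity>"
proof -
  have "((\<lambda>x. x powr (-b)) has_integral (1 powr (-b+1) / (-b+1))) {0..1}"
    using assms by (intro has_integral_powr_from_0) auto
  then have "(\<integral>\<^sup>+x\<in>{0..1}. ennreal (x powr (-b)) \<partial>lborel) < \<infinity>"
    by (subst nn_integral_has_integral_lebesgue') auto
  moreover have "(\<integral>\<^sup>+x\<in>{0<..1}. ennreal (x powr (-b)) \<partial>lborel)
      \<le> (\<integral>\<^sup>+x\<in>{0..1}. ennreal (x powr (-b)) \<partial>lborel)"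
    by (intro nn_integral_mono) (auto simp: indicator_def)
  ultimately show ?thesis by (rule le_less_trans[rotated])
qed

lemma cube_integral_finite_of_monomial_bound:
  assumes "b < 1"
    and bound: "\<And>x. x \<in> (\<Pi>\<^sub>E j\<in>{1..e}. {0<..1}) \<Longrightarrow>
                  1 / (P x powr s) \<le> C * (\<Prod>j=1..e. x j powr (-b))"
  shows "cube_integral e P s < \<infinity>"
proof -
  interpret product_sigma_finite "\<lambda>_::nat. lborel :: real measure" by standard
  define g :: "real \<Rightarrow> ennreal" where "g = (\<lambda>u. ennreal (u powr (-b)) * indicator {0<..1} u)"
  have g[measurable]: "g \<in> borel_measurable lborel" unfolding g_def by measurable
  have "cube_integral e P s
      \<le> (\<integral>\<^sup>+x. ennreal C * (\<Prod>j=1..e. g (x j)) \<partial>(\<Pi>\<^sub>M j\<in>{1..e}. lborel))"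
    unfolding cube_integral_def
  proof (rule nn_integral_mono)
    fix x
    show "ennreal (1 / (P x powr s)) * indicator (\<Pi>\<^sub>E j\<in>{1..e}. {0<..1}) x
        \<le> ennreal C * (\<Prod>j=1..e. g (x j))"
    proof (cases "x \<in> (\<Pi>\<^sub>E j\<in>{1..e}. {0<..1})")
      case True
      then have "g (x j) = ennreal (x j powr (-b))" if "j \<in> {1..e}" for j
        using that by (auto simp: g_def PiE_iff indicator_def)
      then have "(\<Prod>j=1..e. g (x j)) = ennreal (\<Prod>j=1..e. x j powr (-b))"
        by (simp add: prod_ennreal)
      then have "ennreal C * (\<Prod>j=1..e. g (x j)) = ennreal (C * (\<Prod>j=1..e. x j powr (-b)))"
        by (simp add: ennreal_mult'' prod_nonneg)
      then show ?thesis using bound[OF True] True by (simp add: ennreal_leI)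
    qed simp
  qed
  also have "\<dots> = ennreal C * (\<Prod>j=1..e. \<integral>\<^sup>+u. g u \<partial>lborel)"
    by (subst nn_integral_cmult, measurable, subst product_nn_integral_prod) auto
  also have "\<dots> < \<infinity>"
    using nn_integral_powr_unit_interval_finite[OF assms(1)]
    by (simp add: g_def ennreal_mult_less_top power_less_top_ennreal)
  finally show ?thesis .
qed

text \<open>
  The combinatorial inequality is applied to \<open>y\<^sub>j = - ln x\<^sub>j\<close> and \<open>z\<^sub>i = ln k - ln P\<^sub>i(x)\<close>, where
  \<open>k\<close> is a lower bound for the non-zero coefficients.
\<close>

lemma form_product_ge_monomial:
  assumes nonneg: "\<And>i j. i \<in> {1..d} \<Longrightarrow> j \<in> {1..e} \<Longrightarrow> c i j \<ge> 0"
    and nz: "\<And>i. i \<in> {1..d} \<Longrightarrow> nonzero_form e (c i)"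
    and count: "\<And>J. J \<subseteq> {1..e} \<Longrightarrow> J \<noteq> {} \<Longrightarrow>
      real (card {i\<in>{1..d}. form_support e (c i) \<subseteq> J}) \<le> M * real (card J)"
  obtains k where "0 < k"
    "\<And>x. x \<in> (\<Pi>\<^sub>E j\<in>{1..e}. {0<..1}) \<Longrightarrow> k * (\<Prod>j=1..e. x j powr M) \<le> form_product d e c x"
proof -
  define K where "K = insert 1 ((\<lambda>(i,j). c i j) ` {(i,j) \<in> {1..d} \<times> {1..e}. c i j \<noteq> 0})"
  have "finite {(i,j) \<in> {1..d} \<times> {1..e}. c i j \<noteq> 0}"
    by (rule finite_subset[of _ "{1..d} \<times> {1..e}"]) auto
  then have finK: "finite K" unfolding K_def by blast
  define k where "k = Min K"
  have "k \<in> K" unfolding k_def using finK by (intro Min_in) (auto simp: K_def)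
  moreover have "0 < v" if "v \<in> K" for v
    using that nonneg by (force simp: K_def order_less_le)
  ultimately have k: "0 < k" by blast
  have k_le: "k \<le> c i j" if "i \<in> {1..d}" "j \<in> form_support e (c i)" for i j
    unfolding k_def using finK that by (intro Min_le) (force simp: K_def form_support_def)+
  have "k ^ d * (\<Prod>j=1..e. x j powr M) \<le> form_product d e c x"
    if "x \<in> (\<Pi>\<^sub>E j\<in>{1..e}. {0<..1})" for x
  proof -
    have x: "0 < x j" "x j \<le> 1" if "j \<in> {1..e}" for j
      using \<open>x \<in> _\<close> that by (auto simp: PiE_iff)
    have pos: "0 < linear_form e (c i) x" if "i \<in> {1..d}" for i
      using nonneg nz x(1) that by (intro linear_form_pos) auto
    have "(\<Sum>i=1..d. ln k - ln (linear_form e (c i) x)) \<le> M * (\<Sum>j=1..e. - ln (x j))"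
    proof (rule sum_le_of_subset_counts[where S = "\<lambda>i. form_support e (c i)"])
      fix i j assume i: "i \<in> {1..d}" and j: "j \<in> form_support e (c i)"
      then have j': "j \<in> {1..e}" by (simp add: form_support_def)
      have "k * x j \<le> c i j * x j"
        using k_le[OF i j] x(1)[OF j'] by (intro mult_right_mono) auto
      also have "\<dots> \<le> linear_form e (c i) x"
        using nonneg[OF i] x(1) j' by (intro linear_form_ge_term) (auto intro: less_imp_le)
      finally have "ln (k * x j) \<le> ln (linear_form e (c i) x)"
        using k x(1)[OF j'] pos[OF i] by (subst ln_le_cancel_iff) auto
      then show "ln k - ln (linear_form e (c i) x) \<le> - ln (x j)"
        using k x(1)[OF j'] by (simp add: ln_mult)
    next
      fix i assume "i \<in> {1..d}"
      then show "form_support e (c i) \<noteq> {}"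
        using nz[of i] unfolding form_support_def nonzero_form_def by blast
    next
      fix j assume "j \<in> {1..e}"
      then show "0 \<le> - ln (x j)" using x[of j] by simp
    qed (use count in \<open>auto simp: form_support_def\<close>)
    then have "real d * ln k + M * (\<Sum>j=1..e. ln (x j)) \<le> (\<Sum>i=1..d. ln (linear_form e (c i) x))"
      by (simp add: sum_subtractf sum_negf)
    then have "exp (real d * ln k + M * (\<Sum>j=1..e. ln (x j)))
        \<le> exp (\<Sum>i=1..d. ln (linear_form e (c i) x))"
      by simp
    moreover have "exp (real d * ln k + M * (\<Sum>j=1..e. ln (x j))) = k ^ d * (\<Prod>j=1..e. x j powr M)"
    proof -
      have "exp (M * (\<Sum>j=1..e. ln (x j))) = (\<Prod>j=1..e. exp (M * ln (x j)))"
        by (simp add: sum_distrib_left exp_sum)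
      also have "\<dots> = (\<Prod>j=1..e. x j powr M)"
        by (intro prod.cong refl) (use x(1) in \<open>force simp: powr_def\<close>)
      finally show ?thesis using k by (simp add: exp_add exp_of_nat_mult)
    qed
    moreover have "exp (\<Sum>i=1..d. ln (linear_form e (c i) x)) = form_product d e c x"
      unfolding form_product_def using pos by (simp add: exp_sum)
    ultimately show ?thesis by (simp only:)
  qed
  with k show thesis by (intro that[of "k ^ d"]) auto
qed

lemma cube_integral_form_product_finite:
  assumes nonneg: "\<And>i j. i \<in> {1..d} \<Longrightarrow> j \<in> {1..e} \<Longrightarrow> c i j \<ge> 0"
    and nz: "\<And>i. i \<in> {1..d} \<Longrightarrow> nonzero_form e (c i)"
    and count: "\<And>J. J \<subseteq> {1..e} \<Longrightarrow> J \<noteq> {} \<Longrightarrow>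
      real (card {i\<in>{1..d}. form_support e (c i) \<subseteq> J}) \<le> M * real (card J)"
    and s: "0 < s" "s * M < 1"
  shows "cube_integral e (form_product d e c) s < \<infinity>"
proof -
  obtain k where k: "0 < k" and k_le:
    "\<And>x. x \<in> (\<Pi>\<^sub>E j\<in>{1..e}. {0<..1}) \<Longrightarrow> k * (\<Prod>j=1..e. x j powr M) \<le> form_product d e c x"
    using form_product_ge_monomial[OF nonneg nz count] by blast
  show ?thesis
  proof (rule cube_integral_finite_of_monomial_bound[where b = "s * M" and C = "k powr (-s)"])
    fix x :: "nat \<Rightarrow> real" assume x: "x \<in> (\<Pi>\<^sub>E j\<in>{1..e}. {0<..1})"
    then have xpos: "0 < x j" if "j \<in> {1..e}" for j using that by (auto simp: PiE_iff)
    have pos: "0 < (\<Prod>j=1..e. x j powr M)" using xpos by (intro prod_pos) force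
    have "1 / form_product d e c x powr s = form_product d e c x powr (-s)"
      by (simp add: powr_minus_divide)
    also have "\<dots> \<le> (k * (\<Prod>j=1..e. x j powr M)) powr (-s)"
      using k pos k_le[OF x] s by (intro powr_mono2') auto
    also have "\<dots> = k powr (-s) * (\<Prod>j=1..e. (x j powr M) powr (-s))"
      using k pos by (simp add: powr_mult prod_powr_distrib)
    also have "\<dots> = k powr (-s) * (\<Prod>j=1..e. x j powr (-(s * M)))"
      by (simp add: powr_powr mult.commute)
    finally show "1 / form_product d e c x powr s \<le> k powr (-s) * (\<Prod>j=1..e. x j powr (-(s * M)))" .
  qed fact
qed

section \<open>Divergence\<close>

text \<open>
  The hypothesis bounds the integral over \<open>{x | x\<^sub>j \<le> t for j \<in> J}\<close>, a set of volume
  \<open>t\<^sup>#\<^sup>J\<close>, below by \<open>\<delta>\<close>. For \<open>t = 1 / (n + 1)\<close> these sets decrease to the empty set, so if the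
  integral were finite, its parts over them would tend to \<open>0\<close>, by continuity of measures from above.
\<close>

lemma cube_integral_infinite:
  assumes P[measurable]: "P \<in> borel_measurable (\<Pi>\<^sub>M j\<in>{1..e}. lborel)"
    and J: "J \<subseteq> {1..e}" "J \<noteq> {}" and \<delta>: "0 < \<delta>"
    and bound: "\<And>x t. 0 < t \<Longrightarrow> t \<le> 1 \<Longrightarrow> x \<in> (\<Pi>\<^sub>E j\<in>{1..e}. {0<..1}) \<Longrightarrow>
       (\<And>j. j \<in> J \<Longrightarrow> x j \<le> t) \<Longrightarrow> \<delta> / t ^ card J \<le> 1 / (P x powr s)"
  shows "cube_integral e P s = \<infinity>"
proof (rule ccontr)
  assume fin: "cube_integral e P s \<noteq> \<infinity>"
  interpret product_sigma_finite "\<lambda>_::nat. lborel :: real measure" by standard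
  let ?L = "\<Pi>\<^sub>M j\<in>{1..e}. (lborel :: real measure)"
  define Q where "Q = (\<Pi>\<^sub>E j\<in>{1..e}. {0<..1::real})"
  define f where "f = (\<lambda>x. ennreal (1 / (P x powr s)) * indicator Q x)"
  have Q[measurable]: "Q \<in> sets ?L" unfolding Q_def by (intro sets_PiM_I_finite) auto
  have f[measurable]: "f \<in> borel_measurable ?L" unfolding f_def by measurable
  define \<nu> where "\<nu> = density ?L f"
  define A where "A = (\<lambda>n::nat. \<Pi>\<^sub>E j\<in>{1..e}. {0<..if j \<in> J then 1 / real (Suc n) else 1})"
  have A_iff: "x \<in> A n \<longleftrightarrow> x \<in> Q \<and> (\<forall>j\<in>J. x j \<le> 1 / real (Suc n))" for x n
  proof -
    have "u \<le> 1" if "u \<le> 1 / real (Suc n)" for u :: real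
      using that by (rule order_trans) simp
    then show ?thesis using J(1) by (auto simp: A_def Q_def PiE_iff split: if_splits)
  qed
  have A[measurable]: "A n \<in> sets ?L" for n
    unfolding A_def by (intro sets_PiM_I_finite) auto
  have vol: "emeasure ?L (A n) = ennreal ((1 / real (Suc n)) ^ card J)" for n
  proof -
    have "emeasure ?L (A n) = (\<Prod>j\<in>{1..e}. ennreal (if j \<in> J then 1 / real (Suc n) else 1))"
      unfolding A_def by (subst emeasure_PiM) auto
    also have "\<dots> = ennreal (\<Prod>j\<in>{1..e}. if j \<in> J then 1 / real (Suc n) else 1)"
      by (subst prod_ennreal) auto
    also have "(\<Prod>j\<in>{1..e}. if j \<in> J then 1 / real (Suc n) else 1) = (1 / real (Suc n)) ^ card J"
      using J(1) by (simp add: prod.If_cases Int_absorb1 del: of_nat_Suc)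
    finally show ?thesis .
  qed
  have lower: "ennreal \<delta> \<le> emeasure \<nu> (A n)" for n
  proof -
    define t where "t = 1 / real (Suc n)"
    have t: "0 < t" "t \<le> 1" by (auto simp: t_def)
    have "ennreal \<delta> = ennreal (\<delta> / t ^ card J) * emeasure ?L (A n)"
      unfolding vol t_def[symmetric] using t \<delta> by (simp flip: ennreal_mult')
    also have "\<dots> = (\<integral>\<^sup>+x. ennreal (\<delta> / t ^ card J) * indicator (A n) x \<partial>?L)"
      by (rule nn_integral_cmult_indicator[OF A, symmetric])
    also have "\<dots> \<le> (\<integral>\<^sup>+x. f x * indicator (A n) x \<partial>?L)"
    proof (rule nn_integral_mono)
      fix x
      show "ennreal (\<delta> / t ^ card J) * indicator (A n) x \<le> f x * indicator (A n) x"
      proof (cases "x \<in> A n")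
        case True
        then have "\<delta> / t ^ card J \<le> 1 / (P x powr s)"
          using t unfolding A_iff Q_def t_def by (intro bound) auto
        then show ?thesis using True A_iff[of x n] by (simp add: f_def ennreal_leI)
      qed simp
    qed
    also have "\<dots> = emeasure \<nu> (A n)"
      unfolding \<nu>_def by (rule emeasure_density[OF f A, symmetric])
    finally show ?thesis .
  qed
  have total: "emeasure \<nu> (A n) \<noteq> \<infinity>" for n
  proof -
    have "emeasure \<nu> (A n) \<le> cube_integral e P s"
      unfolding \<nu>_def cube_integral_def Q_def[symmetric]
      by (subst emeasure_density[OF f A]) (auto intro!: nn_integral_mono simp: f_def indicator_def)
    then show ?thesis using fin by (auto simp: top_unique)
  qed
  have "decseq A"
  proof (rule decseq_SucI)
    fix n
    have "1 / real (Suc (Suc n)) \<le> 1 / real (Suc n)" by (simp add: field_simps)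
    then show "A (Suc n) \<subseteq> A n" using A_iff by (meson order_trans subsetI)
  qed
  then have "(\<lambda>n. emeasure \<nu> (A n)) \<longlonglongrightarrow> emeasure \<nu> (\<Inter>n. A n)"
    using total A by (intro Lim_emeasure_decseq) (auto simp: \<nu>_def simp del: One_nat_def)
  moreover have "(\<Inter>n. A n) = {}"
  proof (rule ccontr)
    assume "(\<Inter>n. A n) \<noteq> {}"
    then obtain x where x: "x \<in> A n" for n by blast
    obtain j where j: "j \<in> J" using J by blast
    have "x \<in> Q" using x A_iff by blast
    then have "0 < x j" using j J(1) by (auto simp: Q_def PiE_iff)
    then obtain n where "1 / real (Suc n) < x j"
      using reals_Archimedean[of "x j"] by (auto simp: inverse_eq_divide)
    then show False using x[of n] j A_iff[of x n] by (meson not_le)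
  qed
  ultimately have "(\<lambda>n. emeasure \<nu> (A n)) \<longlonglongrightarrow> 0" by simp
  then have "ennreal \<delta> \<le> 0" using lower by (intro LIMSEQ_le_const) auto
  then show False using \<delta> by simp
qed

lemma cube_integral_form_product_infinite:
  assumes nonneg: "\<And>i j. i \<in> {1..d} \<Longrightarrow> j \<in> {1..e} \<Longrightarrow> c i j \<ge> 0"
    and nz: "\<And>i. i \<in> {1..d} \<Longrightarrow> nonzero_form e (c i)"
    and J: "J \<subseteq> {1..e}" "J \<noteq> {}"
    and s: "0 < s" "real (card J) \<le> s * real (card {i\<in>{1..d}. form_support e (c i) \<subseteq> J})"
  shows "cube_integral e (form_product d e c) s = \<infinity>"
proof -
  define B where "B = (\<lambda>i. \<Sum>j=1..e. c i j)"
  have B: "0 < B i" if "i \<in> {1..d}" for i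
    using linear_form_pos[of e "c i" "\<lambda>_. 1"] nonneg nz that
    by (simp add: B_def linear_form_def)
  define D where "D = (\<Prod>i=1..d. B i)"
  have D: "0 < D" unfolding D_def using B by (intro prod_pos) auto
  define N where "N = card {i\<in>{1..d}. form_support e (c i) \<subseteq> J}"
  show ?thesis
  proof (rule cube_integral_infinite[OF form_product_measurable J, where \<delta> = "D powr (-s)"])
    show "0 < D powr (-s)" using D by simp
  next
    fix x :: "nat \<Rightarrow> real" and t :: real
    assume t: "0 < t" "t \<le> 1" and x: "x \<in> (\<Pi>\<^sub>E j\<in>{1..e}. {0<..1})"
      and xt: "\<And>j. j \<in> J \<Longrightarrow> x j \<le> t"
    have x01: "0 < x j" "x j \<le> 1" if "j \<in> {1..e}" for j using x that by (auto simp: PiE_iff)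
    define r where "r = (\<lambda>i. if form_support e (c i) \<subseteq> J then t else 1)"
    have "form_product d e c x \<le> (\<Prod>i=1..d. B i * r i)"
      unfolding form_product_def
    proof (rule prod_mono)
      fix i assume i: "i \<in> {1..d}"
      have "linear_form e (c i) x \<le> B i * r i"
        unfolding B_def using nonneg[OF i] x01 xt
        by (intro linear_form_le) (auto simp: r_def form_support_def)
      moreover have "0 < linear_form e (c i) x"
        using nonneg nz x01 i by (intro linear_form_pos) auto
      ultimately show "0 \<le> linear_form e (c i) x \<and> linear_form e (c i) x \<le> B i * r i" by simp
    qed
    also have "\<dots> = D * t ^ N"
      by (simp add: D_def N_def r_def prod.distrib prod.If_cases Int_def)
    finally have le: "form_product d e c x \<le> D * t ^ N" .
    have "0 < form_product d e c x"
      using nonneg nz x01(1) by (rule form_product_pos)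
    then have "(D * t ^ N) powr (-s) \<le> form_product d e c x powr (-s)"
      using le s by (intro powr_mono2') auto
    moreover have "D powr (-s) / t ^ card J \<le> (D * t ^ N) powr (-s)"
    proof -
      have "t powr (s * real N) \<le> t powr real (card J)"
        using t s(2) by (intro powr_mono') (auto simp: N_def)
      then have "1 / t ^ card J \<le> 1 / t powr (s * real N)"
        using t by (intro divide_left_mono) (auto simp: powr_realpow)
      also have "\<dots> = (t ^ N) powr (-s)"
        using t by (simp add: powr_minus_divide powr_powr mult.commute flip: powr_realpow)
      finally have "D powr (-s) * (1 / t ^ card J) \<le> D powr (-s) * (t ^ N) powr (-s)"
        by (intro mult_left_mono) auto
      then show ?thesis using D t by (simp add: powr_mult)
    qed
    ultimately show "D powr (-s) / t ^ card J \<le> 1 / form_product d e c x powr s"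
      by (simp add: powr_minus_divide)
  qed
qed

section \<open>The critical exponent\<close>

theorem theoremA1:
  fixes d e :: nat and c :: "nat \<Rightarrow> nat \<Rightarrow> real"
  assumes "d \<ge> 1" and "e \<ge> 1"
    and "\<And>i j. i \<in> {1..d} \<Longrightarrow> j \<in> {1..e} \<Longrightarrow> c i j \<ge> 0"
    and "\<And>i. i \<in> {1..d} \<Longrightarrow> nonzero_form e (c i)"
  shows "1 / critical_exponent e (form_product d e c) =
           ereal (MAX J\<in>{J. J \<subseteq> {1..e} \<and> J \<noteq> {}}.
             1 / real (card J) * real (card {i\<in>{1..d}. {j\<in>{1..e}. incidence c i j = 1} \<subseteq> J}))
         \<and> cube_integral e (form_product d e c)
             (real_of_ereal (critical_exponent e (form_product d e c))) = \<infinity>"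
proof -
  note nonneg = assms(3) and nz = assms(4)
  define \<J> where "\<J> = {J. J \<subseteq> {1..e} \<and> J \<noteq> {}}"
  define N where "N = (\<lambda>J. real (card {i\<in>{1..d}. form_support e (c i) \<subseteq> J}))"
  define M where "M = (MAX J\<in>\<J>. 1 / real (card J) * N J)"
  let ?P = "form_product d e c"
  have fin: "finite \<J>" unfolding \<J>_def by simp
  have full: "{1..e} \<in> \<J>" using assms(2) by (auto simp: \<J>_def)
  have card_pos: "0 < card J" if "J \<in> \<J>" for J
    using that by (auto simp: \<J>_def card_gt_0_iff intro: finite_subset)
  have M_ge: "1 / real (card J) * N J \<le> M" if "J \<in> \<J>" for J
    unfolding M_def using fin that by (intro Max_ge) auto
  have count: "N J \<le> M * real (card J)" if "J \<subseteq> {1..e}" "J \<noteq> {}" for J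
    using M_ge[of J] card_pos[of J] that by (simp add: \<J>_def field_simps)
  have "{i\<in>{1..d}. form_support e (c i) \<subseteq> {1..e}} = {1..d}" by (auto simp: form_support_def)
  then have "N {1..e} = real d" by (simp add: N_def)
  then have "0 < 1 / real (card {1..e}) * N {1..e}" using assms(1,2) by simp
  then have M: "0 < M" using M_ge[OF full] by linarith
  have "M \<in> (\<lambda>J. 1 / real (card J) * N J) ` \<J>"
    unfolding M_def using fin full by (intro Max_in) auto
  then obtain J where J: "J \<in> \<J>" "M = 1 / real (card J) * N J" by blast
  have cardJ: "real (card J) * M = N J" using J card_pos[OF J(1)] by simp
  have infinite: "cube_integral e ?P s = \<infinity>" if s: "1 / M \<le> s" for s
  proof (rule cube_integral_form_product_infinite[OF nonneg nz, where J = J])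
    have "0 < 1 / M" using M by simp
    then show "0 < s" using s by linarith
    have "1 \<le> s * M" using s M by (simp add: field_simps)
    then have "real (card J) * 1 \<le> real (card J) * (s * M)" by (intro mult_left_mono) auto
    also have "\<dots> = s * N J" using cardJ by (simp add: algebra_simps)
    finally show "real (card J) \<le> s * real (card {i\<in>{1..d}. form_support e (c i) \<subseteq> J})"
      by (simp add: N_def)
  qed (use J in \<open>auto simp: \<J>_def\<close>)
  have finite: "cube_integral e ?P s < \<infinity>" if "0 < s" "s < 1 / M" for s
  proof (rule cube_integral_form_product_finite[OF nonneg nz])
    show "real (card {i\<in>{1..d}. form_support e (c i) \<subseteq> K}) \<le> M * real (card K)"
      if "K \<subseteq> {1..e}" "K \<noteq> {}" for K using count[OF that] by (simp add: N_def)
    show "s * M < 1" using that M by (simp add: field_simps)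
  qed (use that in auto)
  have "{t. t > 0 \<and> cube_integral e ?P t < \<infinity>} = {0<..<1 / M}"
  proof (intro set_eqI iffI)
    fix t assume t: "t \<in> {t. t > 0 \<and> cube_integral e ?P t < \<infinity>}"
    then have "\<not> 1 / M \<le> t" using infinite[of t] by auto
    with t show "t \<in> {0<..<1 / M}" by auto
  qed (use finite in auto)
  then have "critical_exponent e ?P = Sup (ereal ` {0<..<1 / M})"
    by (simp add: critical_exponent_def)
  also have "ereal ` {0<..<1 / M} = {0<..<ereal (1 / M)}"
  proof (intro set_eqI iffI)
    fix u assume "u \<in> {0<..<ereal (1 / M)}"
    then show "u \<in> ereal ` {0<..<1 / M}" by (cases u) auto
  qed auto
  also have "Sup \<dots> = ereal (1 / M)"
    using M by (intro Sup_greaterThanLessThan) simp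
  finally have crit: "critical_exponent e ?P = ereal (1 / M)" .
  have "1 / critical_exponent e ?P = ereal M"
    unfolding crit using M by (simp add: one_ereal_def)
  moreover have "cube_integral e ?P (real_of_ereal (critical_exponent e ?P)) = \<infinity>"
    unfolding crit by (simp add: infinite)
  ultimately show ?thesis
    unfolding form_support_incidence M_def N_def \<J>_def by blast
qed

end
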